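(* Let $E$ be a real Banach space partially ordered by a cone $K$. Let $A\colon K\to K$ be a monotone operator, and let the cone $K$ be normal. Suppose that there exist numbers $r_0>1$, $n_0\in\mathbb{N}$ and an element $v_0\in K$, $v_0\neq\theta$, such that $$A^{n_0-1}v_0\le A^{n_0}v_0\le r_0A^{n_0-1}v_0 .$$ If the operator $A$ is strongly concave, with a concave mapping $\varphi$, on $$K_1:=\langle A^{n_0-1}v_0,\ \delta A^{n_0-1}v_0\rangle\subset K,$$ where $\delta>r_0$ is the unique solution in $[1,+\infty)$ of the equation $\delta\,\varphi\left(\frac1\delta\right)=r_0$, then: 1) there exists $x^*\in K$, $x^*\neq\theta$, such that $Ax^*=x^*$; 2) there exist numbers $C_0>0$ and $k_0\in(0,1)$ such that $\|A^nv_0-x^*\|\le C_0k_0^n$ for all $n=n_0,n_0+1,\ldots$.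
   Context: $E$ is a real Banach space with zero element $\theta$. A cone $K\subset E$ is a nonempty closed convex set with $tK\subset K$ for all $t\ge0$ and $K\cap(-K)=\{\theta\}$; it induces the partial order $x\le y \iff y-x\in K$. The cone $K$ is normal if there is $\delta'>0$ such that $\|e_1+e_2\|\ge\delta'$ for all $e_1,e_2\in K$ with $\|e_1\|=\|e_2\|=1$ (equivalently, there is $N>0$ such that $\theta\le x\le y$ implies $\|x\|\le N\|y\|$). For $u\le v$, the conical segment is $\langle u,v\rangle=\{x\in E: u\le x\le v\}$. An operator $A\colon K\to K$ is monotone if $x\le y$ implies $Ax\le Ay$; no continuity of $A$ is assumed. $A^n$ denotes the $n$-fold iterate, $A^0$ the identity, and $\mathbb{N}=\{1,2,\ldots\}$. A monotone operator $A$ is strongly concave on a subset $K_1\subseteq K$, with concave mapping $\varphi$, if $\varphi\colon[0,1]\to[0,1]$ is a continuous and monotonically increasing concave mapping with $\varphi(0)=0$, $\varphi(1)=1$, $\varphi'(+0)=+\infty$ such that $A(\sigma u)\ge\varphi(\sigma)Au$ for all $u\in K_1$, $\sigma\in[0,1]$. For such $\varphi$ and $r_0>1$ the equation $\delta\varphi(1/\delta)=r_0$ has a unique solution in $[1,+\infty)$, and this solution satisfies $\delta>r_0$.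
   Formalization: The formal theorem additionally assumes A^{n_0-1}v_0 ≠ θ; without it the claim is false for n_0 ≥ 2 (e.g. A = 0 on K = [0,∞), v_0 = 1, n_0 = 2), and in the excluded case the conclusion always fails. *)

theory Defs
  imports "HOL-Analysis.Analysis"
begin

definition order_cone :: "'a::real_normed_vector set \<Rightarrow> bool" where
  "order_cone K \<longleftrightarrow>
     K \<noteq> {} \<and> closed K \<and> convex K \<and> cone K \<and> K \<inter> uminus ` K = {0}"

definition cone_le :: "'a::real_normed_vector set \<Rightarrow> 'a \<Rightarrow> 'a \<Rightarrow> bool" where
  "cone_le K x y \<longleftrightarrow> y - x \<in> K"

definition normal_cone :: "'a::real_normed_vector set \<Rightarrow> bool" where
  "normal_cone K \<longleftrightarrow>
     (\<exists>d>0. \<forall>e1\<in>K. \<forall>e2\<in>K. norm e1 = 1 \<longrightarrow> norm e2 = 1 \<longrightarrow> norm (e1 + e2) \<ge> d)"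

definition conical_segment :: "'a::real_normed_vector set \<Rightarrow> 'a \<Rightarrow> 'a \<Rightarrow> 'a set" where
  "conical_segment K u v = {x. cone_le K u x \<and> cone_le K x v}"

text \<open>Operators on \<open>K\<close> are total functions; only their values on \<open>K\<close> are constrained.\<close>

definition monotone_operator :: "'a::real_normed_vector set \<Rightarrow> ('a \<Rightarrow> 'a) \<Rightarrow> bool" where
  "monotone_operator K A \<longleftrightarrow>
     A \<in> K \<rightarrow> K \<and> (\<forall>x\<in>K. \<forall>y\<in>K. cone_le K x y \<longrightarrow> cone_le K (A x) (A y))"

text \<open>The limit clause is \<open>\<phi>'(+0) = +\<infinity>\<close>: the right difference quotient at \<open>0\<close> diverges.
  Monotonicity is the non-strict one.\<close>

definition concave_mapping :: "(real \<Rightarrow> real) \<Rightarrow> bool" where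
  "concave_mapping \<phi> \<longleftrightarrow>
     \<phi> \<in> {0..1} \<rightarrow> {0..1} \<and> continuous_on {0..1} \<phi> \<and> mono_on {0..1} \<phi> \<and>
     concave_on {0..1} \<phi> \<and> \<phi> 0 = 0 \<and> \<phi> 1 = 1 \<and>
     filterlim (\<lambda>h. (\<phi> (0 + h) - \<phi> 0) / h) at_top (at_right 0)"

definition strongly_concave_on ::
    "'a::real_normed_vector set \<Rightarrow> 'a set \<Rightarrow> (real \<Rightarrow> real) \<Rightarrow> ('a \<Rightarrow> 'a) \<Rightarrow> bool" where
  "strongly_concave_on K K1 \<phi> A \<longleftrightarrow>
     concave_mapping \<phi> \<and>
     (\<forall>u\<in>K1. \<forall>\<sigma>\<in>{0..1}. cone_le K (\<phi> \<sigma> *\<^sub>R A u) (A (\<sigma> *\<^sub>R u)))"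

end

theory Submission
  imports Defs
begin

text \<open>
  Put \<open>w = (A ^^ (n0 - 1)) v0\<close>. The number \<open>\<delta>\<close> is chosen so that \<open>\<delta> w\<close> is an upper
  solution: strong concavity at \<open>u = \<delta> w\<close>, \<open>\<sigma> = 1 / \<delta>\<close> gives
  \<open>A (\<delta> w) \<le> A w / \<phi> (1 / \<delta>) \<le> (r0 / \<phi> (1 / \<delta>)) w = \<delta> w\<close>.
  So \<open>x\<^sub>n = A\<^sup>n w\<close> increases, \<open>y\<^sub>n = A\<^sup>n (\<delta> w)\<close> decreases and \<open>x\<^sub>n \<le> y\<^sub>n\<close>, all inside
  the segment on which \<open>A\<close> is strongly concave.

  The two sequences squeeze together geometrically. If \<open>x\<^sub>n \<ge> t y\<^sub>n\<close> then
  \<open>x\<^sub>n\<^sub>+\<^sub>1 \<ge> A (t y\<^sub>n) \<ge> \<phi> t y\<^sub>n\<^sub>+\<^sub>1\<close>, so the comparison factor improves from \<open>t\<close> to \<open>\<phi> t\<close>.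
  The infinite slope of \<open>\<phi>\<close> at \<open>0\<close> together with concavity forces \<open>\<phi> t > t\<close> on \<open>(0,1)\<close>, and a
  chord of \<open>\<phi>\<close> ending at \<open>(1,1)\<close> then bounds \<open>1 - \<phi> t\<close> by \<open>k (1 - t)\<close> with a fixed \<open>k < 1\<close>
  for \<open>1 / \<delta> \<le> t \<le> 1\<close> (lemma \<open>concave_mapping_contracts_to_1\<close>). Starting from \<open>x\<^sub>0 = y\<^sub>0 / \<delta>\<close> this gives
  \<open>0 \<le> y\<^sub>n - x\<^sub>n \<le> c k\<^sup>n y\<^sub>0\<close>.

  Normality turns this order estimate into a norm estimate, so \<open>x\<^sub>n\<close> is Cauchy at a geometric
  rate. Closedness of the cone puts the limit \<open>x\<^sup>*\<close> between all \<open>x\<^sub>n\<close> and \<open>y\<^sub>n\<close>. The point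
  \<open>A x\<^sup>*\<close> lies there too by monotonicity alone, and the segments shrink to one point; hence
  \<open>A x\<^sup>* = x\<^sup>*\<close> although \<open>A\<close> may be discontinuous (lemma \<open>shrinking_segments_fixed_point\<close>).
\<close>

section \<open>The order induced by a cone\<close>

lemma order_cone_add: "order_cone K \<Longrightarrow> x \<in> K \<Longrightarrow> y \<in> K \<Longrightarrow> x + y \<in> K"
  unfolding order_cone_def using convex_cone by blast

lemma order_cone_scale: "order_cone K \<Longrightarrow> x \<in> K \<Longrightarrow> c \<ge> 0 \<Longrightarrow> c *\<^sub>R x \<in> K"
  unfolding order_cone_def cone_def by blast

lemma order_cone_zero: "order_cone K \<Longrightarrow> 0 \<in> K"
  unfolding order_cone_def by blast

lemma cone_le_refl: "order_cone K \<Longrightarrow> cone_le K x x"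
  by (simp add: cone_le_def order_cone_zero)

lemma cone_le_trans:
  assumes "order_cone K" "cone_le K x y" "cone_le K y z"
  shows "cone_le K x z"
  using order_cone_add[OF assms(1), of "y - x" "z - y"] assms(2,3)
  by (simp add: cone_le_def)

lemma cone_le_scale:
  assumes "order_cone K" "cone_le K x y" "c \<ge> 0"
  shows "cone_le K (c *\<^sub>R x) (c *\<^sub>R y)"
  using order_cone_scale[OF assms(1), of "y - x" c] assms(2,3)
  by (simp add: cone_le_def scaleR_diff_right)

lemma cone_le_scale_left:
  assumes "order_cone K" "x \<in> K" "a \<le> b"
  shows "cone_le K (a *\<^sub>R x) (b *\<^sub>R x)"
  using order_cone_scale[OF assms(1,2), of "b - a"] assms(3)
  by (simp add: cone_le_def scaleR_diff_left)

lemma cone_le_diff_mono: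
  assumes "order_cone K" "cone_le K a b" "cone_le K c d"
  shows "cone_le K (a - d) (b - c)"
  using order_cone_add[OF assms(1), of "b - a" "d - c"] assms(2,3)
  by (simp add: cone_le_def algebra_simps)

lemma cone_upward_closed:
  assumes "order_cone K" "w \<in> K" "cone_le K w x"
  shows "x \<in> K"
  using order_cone_add[OF assms(1,2), of "x - w"] assms(3) by (simp add: cone_le_def)

lemma cone_le_nonzero:
  assumes "order_cone K" "w \<in> K" "w \<noteq> 0" "cone_le K w x"
  shows "x \<noteq> 0"
proof
  assume "x = 0"
  then have "- w \<in> K" using assms(4) by (simp add: cone_le_def)
  then have "w \<in> K \<inter> uminus ` K" using assms(2) by force
  then show False using assms(1,3) unfolding order_cone_def by blast
qed

text \<open>The order is closed, because \<open>K\<close> is.\<close>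

lemma cone_le_lim_ge:
  assumes "order_cone K" "X \<longlonglongrightarrow> l" "\<forall>\<^sub>F n in sequentially. cone_le K a (X n)"
  shows "cone_le K a l"
proof -
  have "closed K" using assms(1) by (simp add: order_cone_def)
  moreover have "(\<lambda>n. X n - a) \<longlonglongrightarrow> l - a" by (intro tendsto_intros assms(2))
  ultimately show ?thesis
    using Lim_in_closed_set[of K "\<lambda>n. X n - a" sequentially] assms(3)
    by (simp add: cone_le_def)
qed

lemma cone_le_lim_le:
  assumes "order_cone K" "X \<longlonglongrightarrow> l" "\<forall>\<^sub>F n in sequentially. cone_le K (X n) a"
  shows "cone_le K l a"
proof -
  have "closed K" using assms(1) by (simp add: order_cone_def)
  moreover have "(\<lambda>n. a - X n) \<longlonglongrightarrow> a - l" by (intro tendsto_intros assms(2))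
  ultimately show ?thesis
    using Lim_in_closed_set[of K "\<lambda>n. a - X n" sequentially] assms(3)
    by (simp add: cone_le_def)
qed

text \<open>
  For \<open>x, z \<in> K\<close> both nonzero, rescaling \<open>z\<close> to the length of \<open>x\<close> moves \<open>x + z\<close> by
  \<open>\<bar>norm x - norm z\<bar> \<le> norm (x + z)\<close>, and normality bounds the norm of the
  rescaled sum below by \<open>d * norm x\<close>.
\<close>

lemma normal_cone_semi_monotone_norm:
  assumes "normal_cone K" "order_cone K"
  obtains N where "N > 0" "\<And>x y. x \<in> K \<Longrightarrow> cone_le K x y \<Longrightarrow> norm x \<le> N * norm y"
proof -
  obtain d where d: "d > 0"
    "\<And>e1 e2. e1 \<in> K \<Longrightarrow> e2 \<in> K \<Longrightarrow> norm e1 = 1 \<Longrightarrow> norm e2 = 1 \<Longrightarrow> norm (e1 + e2) \<ge> d"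
    using assms(1) unfolding normal_cone_def by blast
  have "norm x \<le> (1 + 2 / d) * norm y" if x: "x \<in> K" and xy: "cone_le K x y" for x y
  proof -
    define z where "z = y - x"
    have z: "z \<in> K" and y: "y = x + z" using xy by (auto simp: cone_le_def z_def)
    consider "x = 0" | "z = 0" | "x \<noteq> 0" "z \<noteq> 0" by blast
    then show ?thesis
    proof cases
      case 1
      then show ?thesis using d(1) by simp
    next
      case 2
      then show ?thesis using d(1) y by (simp add: algebra_simps)
    next
      case 3
      define s where "s = norm x / norm z"
      have "inverse (norm x) *\<^sub>R x \<in> K" "inverse (norm z) *\<^sub>R z \<in> K"
        using order_cone_scale[OF assms(2)] x z by auto
      then have "d \<le> norm (inverse (norm x) *\<^sub>R x + inverse (norm z) *\<^sub>R z)"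
        using d(2) 3 by simp
      then have "norm x * d \<le> norm x * norm (inverse (norm x) *\<^sub>R x + inverse (norm z) *\<^sub>R z)"
        by (rule mult_left_mono) simp
      also have "\<dots> = norm (norm x *\<^sub>R (inverse (norm x) *\<^sub>R x + inverse (norm z) *\<^sub>R z))"
        by simp
      also have "norm x *\<^sub>R (inverse (norm x) *\<^sub>R x + inverse (norm z) *\<^sub>R z) = y + (s - 1) *\<^sub>R z"
        using 3 by (simp add: scaleR_add_right y s_def divide_inverse algebra_simps)
      also have "norm \<dots> \<le> norm y + norm ((s - 1) *\<^sub>R z)"
        by (rule norm_triangle_ineq)
      also have "norm ((s - 1) *\<^sub>R z) = \<bar>(s - 1) * norm z\<bar>"
        by (simp add: abs_mult)
      also have "(s - 1) * norm z = norm x - norm (- z)"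
        using 3 by (simp add: s_def left_diff_distrib)
      also have "\<bar>\<dots>\<bar> \<le> norm y"
        using norm_triangle_ineq3[of x "- z"] y by simp
      finally have "norm x \<le> 2 / d * norm y"
        using d(1) by (simp add: field_simps)
      then show ?thesis by (simp add: algebra_simps add_increasing)
    qed
  qed
  then show thesis using that[of "1 + 2 / d"] d(1) by (simp add: add_pos_pos)
qed

section \<open>Concave mappings with infinite slope at the origin\<close>

text \<open>
  The infinite slope gives some \<open>h < t\<close> with \<open>\<phi> h > h\<close>, and the graph lies above the chord
  from \<open>(h, \<phi> h)\<close> to \<open>(1, 1)\<close>, which lies strictly above the diagonal at \<open>t\<close>.
\<close>

lemma concave_mapping_above_diagonal:
  assumes "concave_mapping \<phi>" "0 < t" "t < 1"
  shows "t < \<phi> t"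
proof -
  have conc: "concave_on {0..1} \<phi>" and one: "\<phi> 1 = 1" and zero: "\<phi> 0 = 0"
    and lim: "filterlim (\<lambda>h. (\<phi> (0 + h) - \<phi> 0) / h) at_top (at_right 0)"
    using assms(1) unfolding concave_mapping_def by auto
  have "\<forall>\<^sub>F h in at_right 0. 1 < \<phi> h / h"
    using lim zero by (simp add: filterlim_at_top_dense)
  moreover have "\<forall>\<^sub>F h in at_right 0. h \<in> {0<..<t}"
    by (rule eventually_at_right_real) (use assms in auto)
  ultimately have "\<forall>\<^sub>F h in at_right (0::real). 1 < \<phi> h / h \<and> h \<in> {0<..<t}"
    by (rule eventually_conj)
  then obtain h where h: "1 < \<phi> h / h" "0 < h" "h < t"
    using eventually_happens[of _ "at_right (0::real)"] trivial_limit_at_right_real by force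
  have hh: "h < \<phi> h" using h by (simp add: field_simps)
  define s where "s = (t - h) / (1 - h)"
  have s: "0 \<le> s" "s < 1" using h assms by (auto simp: s_def field_simps)
  have "s * (1 - h) = t - h" using h assms by (simp add: s_def)
  then have t: "t = (1 - s) * h + s * 1" by (simp add: algebra_simps)
  have "(1 - s) * \<phi> h + s * \<phi> 1 \<le> \<phi> ((1 - s) *\<^sub>R h + s *\<^sub>R 1)"
    by (rule concave_onD[OF conc]) (use s h assms in auto)
  moreover have "(1 - s) * h < (1 - s) * \<phi> h" using hh s by simp
  ultimately show ?thesis using t one by simp
qed

text \<open>
  The rate is the slope of the chord of \<open>\<phi>\<close> over \<open>[t0, 1]\<close>. It vanishes when \<open>\<phi> t0 = 1\<close>, which a
  non-strictly increasing \<open>\<phi>\<close> can satisfy, so the maximum with \<open>1 / 2\<close> keeps it positive.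
\<close>

lemma concave_mapping_contracts_to_1:
  assumes "concave_mapping \<phi>" "0 < t0" "t0 < 1"
  obtains k where "0 < k" "k < 1" "\<And>t. t0 \<le> t \<Longrightarrow> t \<le> 1 \<Longrightarrow> 1 - \<phi> t \<le> k * (1 - t)"
proof -
  have conc: "concave_on {0..1} \<phi>" and one: "\<phi> 1 = 1"
    using assms(1) unfolding concave_mapping_def by auto
  define q where "q = (1 - \<phi> t0) / (1 - t0)"
  have q: "q < 1"
    using concave_mapping_above_diagonal[OF assms] assms(3) by (simp add: q_def field_simps)
  have "1 - \<phi> t \<le> max q (1/2) * (1 - t)" if t: "t0 \<le> t" "t \<le> 1" for t
  proof -
    define s where "s = (t - t0) / (1 - t0)"
    have s: "0 \<le> s" "s \<le> 1" using t assms by (auto simp: s_def field_simps)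
    have s_eq: "s * (1 - t0) = t - t0" using assms by (simp add: s_def)
    then have t_eq: "t = (1 - s) * t0 + s * 1" by (simp add: algebra_simps)
    have "(1 - s) * \<phi> t0 + s * \<phi> 1 \<le> \<phi> ((1 - s) *\<^sub>R t0 + s *\<^sub>R 1)"
      by (rule concave_onD[OF conc]) (use s assms in auto)
    then have "(1 - s) * \<phi> t0 + s \<le> \<phi> t" using one t_eq by simp
    then have "1 - \<phi> t \<le> (1 - s) * (1 - \<phi> t0)" by (simp add: algebra_simps)
    also have "1 - \<phi> t0 = q * (1 - t0)" using assms by (simp add: q_def)
    also have "(1 - s) * (q * (1 - t0)) = q * (1 - t)" using s_eq by algebra
    also have "\<dots> \<le> max q (1/2) * (1 - t)" using t by (intro mult_right_mono) auto
    finally show ?thesis .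
  qed
  then show thesis using that[of "max q (1/2)"] q by auto
qed

section \<open>Order intervals shrinking to a fixed point\<close>

text \<open>
  The width of the order interval \<open>\<langle>x\<^sub>n, y\<^sub>n\<rangle>\<close> bounds the distance of its points from \<open>x\<^sub>n\<close>,
  by normality, and the interval contains the later \<open>x\<^sub>m\<close>, their limit and its image under \<open>A\<close>. This is where
  monotonicity replaces continuity.
\<close>

lemma shrinking_segments_fixed_point:
  fixes K :: "'a::banach set" and x y :: "nat \<Rightarrow> 'a"
  assumes cone: "order_cone K" and normal: "normal_cone K" and mono: "monotone_operator K A"
    and x0: "x 0 \<in> K"
    and xSuc: "\<And>n. x (Suc n) = A (x n)" and ySuc: "\<And>n. y (Suc n) = A (y n)"
    and xinc: "\<And>n. cone_le K (x n) (x (Suc n))" and ydec: "\<And>n. cone_le K (y (Suc n)) (y n)"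
    and xy: "\<And>n. cone_le K (x n) (y n)"
    and width: "\<And>n. cone_le K (y n - x n) ((c * k ^ n) *\<^sub>R u)"
    and c: "0 \<le> c" and k: "0 < k" "k < 1"
  obtains xs C where "cone_le K (x 0) xs" "A xs = xs" "C > 0" "\<And>n. norm (x n - xs) \<le> C * k ^ n"
proof -
  note trans = cone_le_trans[OF cone]
  obtain N where N: "N > 0" "\<And>a b. a \<in> K \<Longrightarrow> cone_le K a b \<Longrightarrow> norm a \<le> N * norm b"
    using normal_cone_semi_monotone_norm[OF normal cone] by blast
  define C where "C = N * c * norm u + 1"
  have C: "C > 0" using N(1) c by (simp add: C_def add_nonneg_pos)
  have close: "norm (b - x n) \<le> C * k ^ n" if "cone_le K (x n) b" "cone_le K b (y n)" for b n
  proof -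
    have "cone_le K (b - x n) (y n - x n)"
      using cone_le_diff_mono[OF cone that(2) cone_le_refl[OF cone]] .
    then have "cone_le K (b - x n) ((c * k ^ n) *\<^sub>R u)" using width trans by blast
    then have "norm (b - x n) \<le> N * norm ((c * k ^ n) *\<^sub>R u)"
      using N(2)[of "b - x n"] that(1)[unfolded cone_le_def] by blast
    also have "\<dots> = (N * c * norm u) * k ^ n" using c k by (simp add: abs_mult)
    also have "\<dots> \<le> C * k ^ n" using k by (intro mult_right_mono) (auto simp: C_def)
    finally show ?thesis .
  qed
  have x_mono: "cone_le K (x n) (x m)" if "n \<le> m" for n m
    using that by (induction m rule: dec_induct) (auto intro: cone_le_refl[OF cone] trans xinc)
  have y_mono: "cone_le K (y m) (y n)" if "n \<le> m" for n m
    using that by (induction m rule: dec_induct) (auto intro: cone_le_refl[OF cone] trans ydec)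
  have xym: "cone_le K (x m) (y n)" if "n \<le> m" for n m
    using trans[OF xy y_mono[OF that]] .
  have rate0: "(\<lambda>n. C * k ^ n) \<longlonglongrightarrow> 0"
    using tendsto_mult_right_zero[OF LIMSEQ_realpow_zero, of k C] k by simp
  have "Cauchy x"
  proof (rule CauchyI')
    fix e :: real assume "e > 0"
    then obtain M where M: "\<And>n. n \<ge> M \<Longrightarrow> C * k ^ n < e"
      using order_tendstoD(2)[OF rate0] by (auto simp: eventually_sequentially)
    show "\<exists>M. \<forall>m\<ge>M. \<forall>n>m. dist (x m) (x n) < e"
    proof (intro exI allI impI)
      fix m n assume mn: "M \<le> m" "m < n"
      have "norm (x n - x m) \<le> C * k ^ m" using close x_mono xym mn by simp
      then show "dist (x m) (x n) < e" using M[OF mn(1)] by (simp add: dist_norm norm_minus_commute)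
    qed
  qed
  then obtain xs where lim: "x \<longlonglongrightarrow> xs"
    using Cauchy_convergent_iff convergent_def by blast
  have lo: "cone_le K (x n) xs" for n
    using eventually_mono[OF eventually_ge_at_top[of n] x_mono] by (rule cone_le_lim_ge[OF cone lim])
  have up: "cone_le K xs (y n)" for n
    using eventually_mono[OF eventually_ge_at_top[of n] xym] by (rule cone_le_lim_le[OF cone lim])
  have xK: "x n \<in> K" for n using cone_upward_closed[OF cone x0] x_mono by simp
  have inK: "xs \<in> K" "y n \<in> K" for n
    using cone_upward_closed[OF cone xK] lo xy by blast+
  have A_le: "cone_le K (A a) (A b)" if "cone_le K a b" "a \<in> K" "b \<in> K" for a b
    using mono that unfolding monotone_operator_def by blast
  have Alo: "cone_le K (x (Suc n)) (A xs)" and Aup: "cone_le K (A xs) (y (Suc n))" for n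
    using A_le lo up xK inK xSuc ySuc by auto
  have "(\<lambda>n. x (Suc n)) \<longlonglongrightarrow> A xs"
  proof (rule LIM_zero_cancel, rule Lim_null_comparison)
    show "(\<lambda>n. C * k ^ Suc n) \<longlonglongrightarrow> 0" using rate0 by (rule LIMSEQ_Suc)
    show "\<forall>\<^sub>F n in sequentially. norm (x (Suc n) - A xs) \<le> C * k ^ Suc n"
      using close[OF Alo Aup] by (simp add: norm_minus_commute)
  qed
  then have "A xs = xs" using LIMSEQ_unique LIMSEQ_Suc[OF lim] by blast
  moreover have "norm (x n - xs) \<le> C * k ^ n" for n
    using close[OF lo up] by (simp add: norm_minus_commute)
  ultimately show thesis using that lo C by blast
qed

section \<open>Strongly concave operators\<close>

text \<open>
  A comparison \<open>w = y\<^sub>0 / \<delta>\<close> between a lower solution \<open>w\<close> and an upper solution \<open>y\<^sub>0 = \<delta> w\<close> is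
  improved at every step, since \<open>x\<^sub>n \<ge> t y\<^sub>n\<close> implies \<open>x\<^sub>n\<^sub>+\<^sub>1 \<ge> \<phi> t y\<^sub>n\<^sub>+\<^sub>1\<close>. The factor
  \<open>1 - (1 - 1 / \<delta>) k\<^sup>n\<close> is a lower bound for the \<open>n\<close>-th iterate \<open>\<phi>\<^sup>n (1 / \<delta>)\<close>.
\<close>

lemma strongly_concave_fixed_point:
  fixes K :: "'a::banach set"
  assumes cone: "order_cone K" and normal: "normal_cone K" and mono: "monotone_operator K A"
    and w: "w \<in> K" and d: "\<delta> > 1"
    and lower: "cone_le K w (A w)" and upper: "cone_le K (A (\<delta> *\<^sub>R w)) (\<delta> *\<^sub>R w)"
    and conc: "strongly_concave_on K (conical_segment K w (\<delta> *\<^sub>R w)) \<phi> A"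
  obtains xs C k where "cone_le K w xs" "A xs = xs" "C > 0" "0 < k" "k < 1"
    "\<And>n. norm ((A ^^ n) w - xs) \<le> C * k ^ n"
proof -
  note trans = cone_le_trans[OF cone]
  have phi: "concave_mapping \<phi>"
    and A_scale: "\<And>u \<sigma>. cone_le K w u \<Longrightarrow> cone_le K u (\<delta> *\<^sub>R w) \<Longrightarrow> 0 \<le> \<sigma> \<Longrightarrow> \<sigma> \<le> 1
      \<Longrightarrow> cone_le K (\<phi> \<sigma> *\<^sub>R A u) (A (\<sigma> *\<^sub>R u))"
    using conc by (auto simp: strongly_concave_on_def conical_segment_def)
  have A_in: "A a \<in> K" if "a \<in> K" for a
    using mono that unfolding monotone_operator_def by blast
  have A_le: "cone_le K (A a) (A b)" if "cone_le K a b" "a \<in> K" "b \<in> K" for a b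
    using mono that unfolding monotone_operator_def by blast
  define t0 where "t0 = 1 / \<delta>"
  have t0: "0 < t0" "t0 < 1" using d by (auto simp: t0_def)
  obtain k where k: "0 < k" "k < 1" "\<And>t. t0 \<le> t \<Longrightarrow> t \<le> 1 \<Longrightarrow> 1 - \<phi> t \<le> k * (1 - t)"
    using concave_mapping_contracts_to_1[OF phi t0] by blast
  define x where "x n = (A ^^ n) w" for n
  define y where "y n = (A ^^ n) (\<delta> *\<^sub>R w)" for n
  have xSuc: "x (Suc n) = A (x n)" and ySuc: "y (Suc n) = A (y n)" for n
    by (simp_all add: x_def y_def)
  have x_in: "x n \<in> K" for n by (induction n) (auto simp: xSuc A_in w x_def[of 0])
  have y_in: "y n \<in> K" for n
    by (induction n) (use d in \<open>auto simp: ySuc A_in w y_def[of 0] order_cone_scale[OF cone]\<close>)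
  have xinc: "cone_le K (x n) (x (Suc n))" for n
  proof (induction n)
    case 0
    show ?case using lower by (simp add: x_def)
  next
    case (Suc n)
    then show ?case using A_le x_in xSuc by metis
  qed
  have ydec: "cone_le K (y (Suc n)) (y n)" for n
  proof (induction n)
    case 0
    show ?case using upper by (simp add: y_def)
  next
    case (Suc n)
    then show ?case using A_le y_in ySuc by metis
  qed
  have xy: "cone_le K (x n) (y n)" for n
  proof (induction n)
    case 0
    show ?case using cone_le_scale_left[OF cone w, of 1 \<delta>] d by (simp add: x_def y_def)
  next
    case (Suc n)
    then show ?case using A_le x_in y_in xSuc ySuc by metis
  qed
  have x_ge: "cone_le K w (x n)" for n
    by (induction n) (auto simp: x_def[of 0] cone_le_refl[OF cone] intro: trans xinc)
  have y_le: "cone_le K (y n) (\<delta> *\<^sub>R w)" for n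
    by (induction n) (auto simp: y_def[of 0] cone_le_refl[OF cone] intro: trans ydec)
  define t where "t n = 1 - (1 - t0) * k ^ n" for n
  have t: "t0 \<le> t n" "t n \<le> 1" for n
  proof -
    have "0 \<le> k ^ n" "k ^ n \<le> 1" using k by (auto intro: power_le_one)
    then have "0 \<le> (1 - t0) * k ^ n" "(1 - t0) * k ^ n \<le> (1 - t0) * 1"
      using t0 by (auto intro: mult_left_mono)
    then show "t0 \<le> t n" "t n \<le> 1" by (auto simp: t_def)
  qed
  have tx: "cone_le K (t n *\<^sub>R y n) (x n)" for n
  proof (induction n)
    case 0
    show ?case using d by (simp add: t_def x_def y_def t0_def cone_le_refl[OF cone])
  next
    case (Suc n)
    have t_nonneg: "0 \<le> t n" using t(1)[of n] t0 by simp
    have "t (Suc n) \<le> \<phi> (t n)" using k(3)[OF t, of n] by (simp add: t_def algebra_simps)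
    then have "cone_le K (t (Suc n) *\<^sub>R y (Suc n)) (\<phi> (t n) *\<^sub>R A (y n))"
      using cone_le_scale_left[OF cone y_in] ySuc by metis
    moreover have "cone_le K (\<phi> (t n) *\<^sub>R A (y n)) (A (t n *\<^sub>R y n))"
      by (rule A_scale[OF trans[OF x_ge xy] y_le t_nonneg t(2)])
    moreover have "cone_le K (A (t n *\<^sub>R y n)) (x (Suc n))"
      using A_le[OF Suc order_cone_scale[OF cone y_in t_nonneg] x_in] xSuc by simp
    ultimately show ?case using trans by blast
  qed
  have width: "cone_le K (y n - x n) (((1 - t0) * k ^ n) *\<^sub>R (\<delta> *\<^sub>R w))" for n
  proof -
    have "cone_le K (y n - x n) (y n - t n *\<^sub>R y n)"
      by (rule cone_le_diff_mono[OF cone cone_le_refl[OF cone] tx])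
    moreover have "y n - t n *\<^sub>R y n = ((1 - t0) * k ^ n) *\<^sub>R y n"
      by (simp add: t_def scaleR_diff_left)
    moreover have "cone_le K (((1 - t0) * k ^ n) *\<^sub>R y n) (((1 - t0) * k ^ n) *\<^sub>R (\<delta> *\<^sub>R w))"
      by (rule cone_le_scale[OF cone y_le]) (use t0 k in simp)
    ultimately show ?thesis using trans by metis
  qed
  have "0 \<le> 1 - t0" using t0 by simp
  from shrinking_segments_fixed_point[OF cone normal mono x_in xSuc ySuc xinc ydec xy width this k(1,2)]
  obtain xs C where "cone_le K (x 0) xs" "A xs = xs" "C > 0" "\<And>n. norm (x n - xs) \<le> C * k ^ n"
    by blast
  then show thesis using that k by (simp add: x_def)
qed

theorem theorem2:
  fixes K :: "'a::banach set" and A :: "'a \<Rightarrow> 'a" and v0 :: 'a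
    and \<phi> :: "real \<Rightarrow> real" and r0 \<delta> :: real and n0 :: nat
  assumes "order_cone K" and "normal_cone K"
    and "monotone_operator K A"
    and "r0 > 1" and "n0 \<ge> 1"
    and "v0 \<in> K" and "v0 \<noteq> 0"
    and "(A ^^ (n0 - 1)) v0 \<noteq> 0"
    and "cone_le K ((A ^^ (n0 - 1)) v0) ((A ^^ n0) v0)"
    and "cone_le K ((A ^^ n0) v0) (r0 *\<^sub>R (A ^^ (n0 - 1)) v0)"
    and "\<delta> \<ge> 1" and "\<delta> * \<phi> (1 / \<delta>) = r0"
    and "strongly_concave_on K
           (conical_segment K ((A ^^ (n0 - 1)) v0) (\<delta> *\<^sub>R (A ^^ (n0 - 1)) v0)) \<phi> A"
  shows "\<exists>xs\<in>K. xs \<noteq> 0 \<and> A xs = xs \<and>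
           (\<exists>C0>0. \<exists>k0. 0 < k0 \<and> k0 < 1 \<and>
              (\<forall>n\<ge>n0. norm ((A ^^ n) v0 - xs) \<le> C0 * k0 ^ n))"
proof -
  define w where "w = (A ^^ (n0 - 1)) v0"
  have Aw: "(A ^^ n0) v0 = A w"
    using assms(5) by (cases n0) (auto simp: w_def)
  note cone = assms(1)
  have A_in: "\<And>a. a \<in> K \<Longrightarrow> A a \<in> K"
    using assms(3) unfolding monotone_operator_def by blast
  have w: "w \<in> K"
  proof -
    have "(A ^^ n) v0 \<in> K" for n by (induction n) (auto simp: A_in assms(6))
    then show ?thesis by (simp add: w_def)
  qed
  have conc: "strongly_concave_on K (conical_segment K w (\<delta> *\<^sub>R w)) \<phi> A"
    using assms(13) by (simp add: w_def)
  then have "\<phi> 1 = 1" by (simp add: strongly_concave_on_def concave_mapping_def)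
  then have d: "\<delta> > 1" using assms(4,11,12) by (cases "\<delta> = 1") auto
  have phi_pos: "\<phi> (1 / \<delta>) > 0"
    using assms(4,12) d zero_less_mult_iff[of \<delta> "\<phi> (1 / \<delta>)"] by simp
  have upper: "cone_le K (A (\<delta> *\<^sub>R w)) (\<delta> *\<^sub>R w)"
  proof -
    have "\<delta> *\<^sub>R w \<in> conical_segment K w (\<delta> *\<^sub>R w)"
      using cone_le_scale_left[OF cone w, of 1 \<delta>] d
      by (simp add: conical_segment_def cone_le_refl[OF cone])
    moreover have "1 / \<delta> \<in> {0..1}" using d by simp
    ultimately have "cone_le K (\<phi> (1 / \<delta>) *\<^sub>R A (\<delta> *\<^sub>R w)) (A ((1 / \<delta>) *\<^sub>R \<delta> *\<^sub>R w))"
      using conc unfolding strongly_concave_on_def by blast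
    then have "cone_le K (\<phi> (1 / \<delta>) *\<^sub>R A (\<delta> *\<^sub>R w)) (A w)" using d by simp
    then have "cone_le K (\<phi> (1 / \<delta>) *\<^sub>R A (\<delta> *\<^sub>R w)) (r0 *\<^sub>R w)"
      using cone_le_trans[OF cone] assms(10) Aw w_def by metis
    then have "cone_le K (inverse (\<phi> (1 / \<delta>)) *\<^sub>R \<phi> (1 / \<delta>) *\<^sub>R A (\<delta> *\<^sub>R w))
        (inverse (\<phi> (1 / \<delta>)) *\<^sub>R r0 *\<^sub>R w)"
      by (rule cone_le_scale[OF cone]) (use phi_pos in simp)
    moreover have "inverse (\<phi> (1 / \<delta>)) * r0 = \<delta>"
      using assms(12) phi_pos by (simp add: field_simps)
    ultimately show ?thesis using phi_pos by simp
  qed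
  have lower: "cone_le K w (A w)" using assms(9) Aw w_def by simp
  obtain xs C k where xs: "cone_le K w xs" "A xs = xs" "C > 0" "0 < k" "k < 1"
    "\<And>n. norm ((A ^^ n) w - xs) \<le> C * k ^ n"
    using strongly_concave_fixed_point[OF cone assms(2,3) w d lower upper conc] by blast
  have "norm ((A ^^ n) v0 - xs) \<le> C / k ^ (n0 - 1) * k ^ n" if "n \<ge> n0" for n
  proof -
    define m where "m = n - (n0 - 1)"
    have n: "n = m + (n0 - 1)" using that by (simp add: m_def)
    have "(A ^^ n) v0 = (A ^^ m) w" by (simp add: n w_def funpow_add)
    moreover have "C / k ^ (n0 - 1) * k ^ n = C * k ^ m"
      using xs(4) by (simp add: n power_add)
    ultimately show ?thesis using xs(6)[of m] by simp
  qed
  moreover have "C / k ^ (n0 - 1) > 0" using xs by simp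
  moreover have "xs \<in> K" using cone_upward_closed[OF cone w xs(1)] .
  moreover have "xs \<noteq> 0"
    using cone_le_nonzero[OF cone w _ xs(1)] assms(8) w_def by simp
  ultimately show ?thesis using xs(2,4,5) by blast
qed

end
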